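(* Let $A=\{A_1,\dots,A_n\}$ be a finite set (a source alphabet), let $p=\{p_1,\dots,p_n\}$ be the probability set assigned to $A$, and suppose that $p$ has an achievable state $f=\{f_1,\dots,f_n\}$. Suppose that only the natural constraint $\sum_{i=1}^n p_i=1$ is put on $A$, and that the entropy $S=S(p_1,\dots,p_n)$, taken as the target function for the extremization with the Maximal Entropy Principle, satisfies the following two conditions: 1) if $\left.\frac{\partial S}{\partial p_i}\right|_{p=f}$ equals one and the same constant for all $i$, then $f_i=\frac1n$ for all $i$; 2) if $\left.\frac{\partial S}{\partial p_i}\right|_{p=f}$ equals one and the same constant for all $i$, then $S$ becomes maximal (at $p=f$). Then the equilibrium distribution $f$ is, and can only be, the uniform distribution: the uniform distribution $f_i=\frac1n$ for all $i$ is the equilibrium distribution, and no other distribution is.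
   Context: The Maximal Entropy Principle means maximizing the target function $S(p)$ over probability sets $p$ subject to the constraints imposed; the resulting maximal-entropy distribution $f$ is called the equilibrium distribution. It is obtained by the method of Lagrange multipliers: under the natural constraint alone one forms $L=S-\mu\sum_{i=1}^n p_i$ with an undetermined multiplier $\mu$ and sets $\left.\frac{\partial L}{\partial p_i}\right|_{p=f}=0$ for all $i$, i.e. $\left.\frac{\partial S}{\partial p_i}\right|_{p=f}=\mu$ for all $i$. The partial derivatives of $S$ appearing here are understood to exist.
   Formalization: Conditions 1) and 2) are required at every probability set, not only at f; the achievable state f is taken to solve the Lagrange equations; an equilibrium distribution means one that both solves these equations and maximizes S. The literal claim fails, e.g. for constant S or S = p_1. *)

theory Defs
  imports "HOL-Analysis.Analysis"
begin

(* A finite alphabet is a type 'a of class finite; n is CARD('a), and the letters A_i are the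
   elements i of 'a.  The entropy S is a function of n independent real variables: its partial
   derivatives leave the hyperplane given by the natural constraint. *)

definition prob_set :: "real ^ 'a::finite \<Rightarrow> bool" where
  "prob_set p \<longleftrightarrow> (\<forall>i. 0 \<le> p $ i) \<and> (\<Sum>i\<in>UNIV. p $ i) = 1"

definition has_partial_derivative ::
    "(real ^ 'a::finite \<Rightarrow> real) \<Rightarrow> 'a \<Rightarrow> real \<Rightarrow> real ^ 'a \<Rightarrow> bool" where
  "has_partial_derivative F i D x \<longleftrightarrow>
     ((\<lambda>t. F (\<chi> j. if j = i then t else x $ j)) has_real_derivative D) (at (x $ i))"

definition lagrangian :: "(real ^ 'a::finite \<Rightarrow> real) \<Rightarrow> real \<Rightarrow> real ^ 'a \<Rightarrow> real" where
  "lagrangian S \<mu> p = S p - \<mu> * (\<Sum>i\<in>UNIV. p $ i)"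

definition lagrange_stationary :: "(real ^ 'a::finite \<Rightarrow> real) \<Rightarrow> real ^ 'a \<Rightarrow> bool" where
  "lagrange_stationary S f \<longleftrightarrow>
     prob_set f \<and> (\<exists>\<mu>. \<forall>i. has_partial_derivative (lagrangian S \<mu>) i 0 f)"

(* The maximal-entropy distribution as obtained by the method of Lagrange multipliers.
   Stationarity is a separate requirement: it does not follow from maximality, for example when
   the maximum lies on the boundary of the simplex or when S has partial derivatives without
   being differentiable. *)
definition equilibrium :: "(real ^ 'a::finite \<Rightarrow> real) \<Rightarrow> real ^ 'a \<Rightarrow> bool" where
  "equilibrium S f \<longleftrightarrow> lagrange_stationary S f \<and> is_arg_max S prob_set f"

end

theory Submission imports Defs begin

text \<open>The penalty term is linear with slope \<mu> in every coordinate, so stationarity of the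
  Lagrangian means that all partial derivatives of \<open>S\<close> share the value \<mu>: exactly
  the premise of \<open>cond1\<close> and \<open>cond2\<close>. The achievable state
  \<open>f\<close> is therefore uniform and maximal, and every equilibrium, being stationary, is
  uniform too.\<close>

lemma has_partial_derivative_lagrangian_iff:
  "has_partial_derivative (lagrangian S \<mu>) i D x \<longleftrightarrow> has_partial_derivative S i (D + \<mu>) x"
proof -
  have "((\<lambda>t. if j = i then t else x $ j) has_real_derivative (if j = i then 1 else 0))
      (at (x $ i))" for j
    by simp
  then have "((\<lambda>t. \<Sum>j\<in>UNIV. if j = i then t else x $ j) has_real_derivative
      (\<Sum>j\<in>UNIV. if j = i then 1 else 0)) (at (x $ i))"
    by (intro DERIV_sum)
  then have penalty: "((\<lambda>t. \<mu> * (\<Sum>j\<in>UNIV. if j = i then t else x $ j)) has_real_derivative \<mu>)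
      (at (x $ i))"
    by (auto dest: DERIV_cmult[where c = \<mu>])
  show ?thesis
    unfolding has_partial_derivative_def lagrangian_def
    \<comment> \<open>Adding the penalty back to the Lagrangian recovers \<open>S\<close>;
      subtracting it gives the converse.\<close>
    using DERIV_add[OF _ penalty] DERIV_diff[OF _ penalty] by fastforce
qed

text \<open>The case \<open>D = 0\<close>: the multiplier becomes the common constant of the two
  conditions.\<close>

lemma lagrange_stationary_iff:
  "lagrange_stationary S f \<longleftrightarrow> prob_set f \<and> (\<exists>\<mu>. \<forall>i. has_partial_derivative S i \<mu> f)"
  by (simp add: lagrange_stationary_def has_partial_derivative_lagrangian_iff)

theorem theorem6:
  fixes S :: "real ^ 'a::finite \<Rightarrow> real" and f :: "real ^ 'a"
  assumes achievable: "lagrange_stationary S f"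
    and cond1: "\<And>g. prob_set g \<Longrightarrow> \<exists>c. \<forall>i. has_partial_derivative S i c g \<Longrightarrow>
                  \<forall>i. g $ i = 1 / real CARD('a)"
    and cond2: "\<And>g. prob_set g \<Longrightarrow> \<exists>c. \<forall>i. has_partial_derivative S i c g \<Longrightarrow>
                  is_arg_max S prob_set g"
  shows "equilibrium S f \<and>
         (\<forall>g. equilibrium S g \<longleftrightarrow> (\<forall>i. g $ i = 1 / real CARD('a)))"
proof -
  have uniform: "\<forall>i. g $ i = 1 / real CARD('a)" if "lagrange_stationary S g" for g
    using that cond1 unfolding lagrange_stationary_iff by blast
  have f: "equilibrium S f"
    using achievable cond2 unfolding equilibrium_def lagrange_stationary_iff by blast
  \<comment> \<open>The uniform vector is unique, so it is \<open>f\<close> and inherits being an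
    equilibrium from it.\<close>
  have "g = f" if "\<forall>i. g $ i = 1 / real CARD('a)" for g
    using that uniform[OF achievable] by (simp add: vec_eq_iff)
  with f uniform show ?thesis
    unfolding equilibrium_def by blast
qed

end
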